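(* Let $f(t)=\int_0^t\sqrt{\cosh s}\,ds$ and let $B,C,E,F,B',C',E',F'\in\mathbb R$ satisfy $BE'+CF'=B'E+C'F$. Define functions $w_j,p_j,q_j:\mathbb R\to\mathbb C$, $j=1,2,3$, by $$w_1=\tanh t,\qquad w_2=w_3=\operatorname{sech}t,$$ $$p_1=B\bigl(f(t)\tanh t-2\sqrt{\cosh t}\bigr)+\frac{iE}{\sqrt{\cosh t}},$$ $$p_2=B f(t)\operatorname{sech}t+C\sqrt{\cosh t}+\frac{iE\sinh t}{2\sqrt{\cosh t}}+\frac{iF}{\sqrt{\cosh t}},\qquad p_3=B f(t)\operatorname{sech}t-C\sqrt{\cosh t}+\frac{iE\sinh t}{2\sqrt{\cosh t}}-\frac{iF}{\sqrt{\cosh t}},$$ and let $q_1,q_2,q_3$ be given by the same formulas as $p_1,p_2,p_3$ respectively, with $B,C,E,F$ replaced by $B',C',E',F'$. Let $r_1,r_2,r_3:\mathbb R\to\mathbb C$ be the unique solutions of $$\frac{dr_1}{dt}=\tfrac12(\bar p_2\bar p_3+\bar q_3\bar q_2),\qquad \frac{dr_2}{dt}=\tfrac12(\bar q_3\bar q_1-\bar p_1\bar p_3),\qquad \frac{dr_3}{dt}=-\tfrac12(\bar p_1\bar q_2+\bar p_2\bar q_1)$$ with $r_j(0)=0$. Define $$N=\Bigl\{\bigl(\tfrac12(y_1^2+y_2^2)w_1(t)+y_1p_1(t)+y_2q_1(t)+r_1(t),\ \tfrac12(y_1^2-y_2^2)w_2(t)+y_1p_2(t)-y_2q_2(t)+r_2(t),\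 y_1y_2w_3(t)+y_1q_3(t)+y_2p_3(t)+r_3(t)\bigr):t,y_1,y_2\in\mathbb R\Bigr\}\subset\mathbb C^3.$$ Then $N$ is a special Lagrangian $3$-fold (wherever it is nonsingular).
   Context: On $\mathbb C^3$ set $\omega=\frac i2\sum_j dz_j\wedge d\bar z_j$ and $\Omega=dz_1\wedge dz_2\wedge dz_3$. A special Lagrangian $3$-fold is an oriented real $3$-dimensional submanifold $L$ calibrated by $\operatorname{Re}\Omega$; equivalently, a real $3$-submanifold (with a suitable orientation) on which $\omega|_L\equiv0$ and $\operatorname{Im}\Omega|_L\equiv0$. "Wherever it is nonsingular" refers to the points where $N$, the image of the displayed parametrization by $(y_1,y_2,t)$, is a nonsingular (immersed) $3$-submanifold, in particular where the parametrization is an immersion. *)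

theory Defs
  imports "HOL-Analysis.Analysis"
begin

section \<open>Special Lagrangian 3-folds in complex 3-space\<close>

text \<open>The holomorphic volume form, evaluated on three real tangent vectors.  The real inner product
  of the library on \<^typ>\<open>complex^3\<close> is the Euclidean metric belonging to the standard Kaehler form.\<close>

definition Omega :: "complex^3 \<Rightarrow> complex^3 \<Rightarrow> complex^3 \<Rightarrow> complex" where
  "Omega u v w = det (vector [u, v, w] :: complex^3^3)"

text \<open>The 3-dimensional volume of the parallelepiped spanned by three real tangent vectors: on an
  oriented 3-plane the Riemannian volume form takes this value on positively oriented frames and
  its negative on negatively oriented ones.\<close>

definition vol3 :: "complex^3 \<Rightarrow> complex^3 \<Rightarrow> complex^3 \<Rightarrow> real" where
  "vol3 u v w =
     sqrt (det (\<chi> i j. (vector [u, v, w] :: (complex^3)^3) $ i \<bullet> (vector [u, v, w] :: (complex^3)^3) $ j))"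

definition C1_immersion ::
  "(real^3) set \<Rightarrow> (real^3 \<Rightarrow> complex^3) \<Rightarrow> (real^3 \<Rightarrow> ((real^3) \<Rightarrow>\<^sub>L (complex^3))) \<Rightarrow> bool" where
  "C1_immersion U \<phi> \<phi>' \<longleftrightarrow>
     open U \<and> continuous_on U \<phi>' \<and>
     (\<forall>x\<in>U. (\<phi> has_derivative blinfun_apply (\<phi>' x)) (at x) \<and> inj (blinfun_apply (\<phi>' x)))"

text \<open>An immersion is special Lagrangian if, for a suitable orientation of \<^term>\<open>U\<close>, it is
  calibrated by the real part of the holomorphic volume form.  The orientation is given by its
  sign relative to the standard orientation of the parameter space.\<close>

definition special_Lagrangian_immersion ::
  "(real^3) set \<Rightarrow> (real^3 \<Rightarrow> complex^3) \<Rightarrow> (real^3 \<Rightarrow> ((real^3) \<Rightarrow>\<^sub>L (complex^3))) \<Rightarrow> bool" where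
  "special_Lagrangian_immersion U \<phi> \<phi>' \<longleftrightarrow>
     C1_immersion U \<phi> \<phi>' \<and>
     (\<exists>\<sigma> :: real^3 \<Rightarrow> real. continuous_on U \<sigma> \<and> \<sigma> ` U \<subseteq> {1, -1} \<and>
        (\<forall>x\<in>U. Re (Omega (\<phi>' x (axis 1 1)) (\<phi>' x (axis 2 1)) (\<phi>' x (axis 3 1))) =
                \<sigma> x * vol3 (\<phi>' x (axis 1 1)) (\<phi>' x (axis 2 1)) (\<phi>' x (axis 3 1))))"

text \<open>A set is special Lagrangian wherever it is nonsingular if every piece of it that is an
  immersed 3-dimensional submanifold is special Lagrangian.  A piece is given in local parameters;
  pieces of class \<open>C\<^sup>1\<close> are allowed, which includes the smooth ones.  The pieces include local
  parametrizations of the set around points where it is an embedded submanifold, the individual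
  sheets through self-intersection points, and any given parametrization of the set
  restricted to the points where it is an immersion.  A calibrated orientation is the one for
  which the real part of \<^const>\<open>Omega\<close> is positive, so the orientations of overlapping pieces agree.\<close>

definition special_Lagrangian_where_nonsingular :: "(complex^3) set \<Rightarrow> bool" where
  "special_Lagrangian_where_nonsingular N \<longleftrightarrow>
     (\<forall>U \<phi> \<phi>'. C1_immersion U \<phi> \<phi>' \<and> \<phi> ` U \<subseteq> N \<longrightarrow> special_Lagrangian_immersion U \<phi> \<phi>')"

section \<open>The functions entering the construction\<close>

text \<open>The interval integral is oriented, as is needed for negative \<^term>\<open>t\<close>.\<close>

definition f_int :: "real \<Rightarrow> real" where
  "f_int t = (LBINT s=ereal 0..ereal t. sqrt (cosh s))"

definition w1 :: "real \<Rightarrow> complex" where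
  "w1 t = complex_of_real (tanh t)"

definition w2 :: "real \<Rightarrow> complex" where
  "w2 t = complex_of_real (1 / cosh t)"

definition w3 :: "real \<Rightarrow> complex" where
  "w3 t = complex_of_real (1 / cosh t)"

text \<open>The functions \<open>p\<^sub>j\<close> and \<open>q\<^sub>j\<close> are the following ones with parameters \<open>B, C, E, F\<close> and
  \<open>B', C', E', F'\<close> respectively.\<close>

definition pq1 :: "real \<Rightarrow> real \<Rightarrow> real \<Rightarrow> complex" where
  "pq1 B E t =
     complex_of_real (B * (f_int t * tanh t - 2 * sqrt (cosh t)))
     + \<i> * complex_of_real (E / sqrt (cosh t))"

definition pq2 :: "real \<Rightarrow> real \<Rightarrow> real \<Rightarrow> real \<Rightarrow> real \<Rightarrow> complex" where
  "pq2 B C E F t =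
     complex_of_real (B * f_int t * (1 / cosh t) + C * sqrt (cosh t))
     + \<i> * complex_of_real (E * sinh t / (2 * sqrt (cosh t)))
     + \<i> * complex_of_real (F / sqrt (cosh t))"

definition pq3 :: "real \<Rightarrow> real \<Rightarrow> real \<Rightarrow> real \<Rightarrow> real \<Rightarrow> complex" where
  "pq3 B C E F t =
     complex_of_real (B * f_int t * (1 / cosh t) - C * sqrt (cosh t))
     + \<i> * complex_of_real (E * sinh t / (2 * sqrt (cosh t)))
     - \<i> * complex_of_real (F / sqrt (cosh t))"

end

theory Submission imports Defs begin

text \<open>
  Write \<open>\<Phi>(y\<^sub>1, y\<^sub>2, t)\<close> for the displayed parametrization, \<open>a\<close> and \<open>b\<close> for its derivatives along
  \<open>y\<^sub>1\<close> and \<open>y\<^sub>2\<close>, and \<open>a \<times> b\<close> for the complex conjugate of their complex cross product.  The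
  differential equations satisfied by \<open>w\<^sub>j, p\<^sub>j, q\<^sub>j, r\<^sub>j\<close> say, coefficient by coefficient in \<open>y\<^sub>1, y\<^sub>2\<close>,
  that \<open>\<partial>\<Phi>/\<partial>t = (a \<times> b)/2\<close>: the quadric \<open>\<Phi>(\<cdot>, \<cdot>, t)\<close> is evolved along its own conjugate cross
  product.  This vector is Hermitian-orthogonal to \<open>a\<close> and \<open>b\<close>, and the volume form takes the real
  value \<open>|a \<times> b|\<^sup>2\<close> on \<open>(a, b, a \<times> b)\<close>.  So the only further condition for \<open>\<omega>\<close> and the imaginary
  part of \<open>\<Omega>\<close> to vanish on the image of the derivative of \<open>\<Phi>\<close> is \<open>\<omega>(a, b) = 0\<close>.  As a polynomial in
  \<open>y\<^sub>1, y\<^sub>2\<close> all coefficients of positive degree of this quantity vanish identically, and its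
  constant coefficient is \<open>2(BE' + CF' - B'E - C'F)\<close> up to sign.

  What has to be shown concerns arbitrary immersed \<open>C\<^sup>1\<close> pieces \<open>\<phi>\<close> of the set \<open>N\<close>, and \<open>\<phi>\<close> need not
  factor through \<open>\<Phi>\<close>: it may pass through the image of the critical points of \<open>\<Phi>\<close> or change
  sheets of \<open>N\<close>.  But the conditions on the tangent spaces of \<open>\<phi>\<close> are closed, so it is enough
  to have them at a dense set of parameters, and there \<open>\<phi>\<close> does factor.  This is
  \<open>immersed_piece_tangent\<close>: project orthogonally onto one tangent space of \<open>\<phi>\<close>, so that \<open>\<phi>\<close> becomes
  a local diffeomorphism; by Sard's theorem the critical values of the projected \<open>\<Phi>\<close> form a countable
  union of compact sets without interior, the regular points are covered by countably many
  compact balls on which the projected \<open>\<Phi>\<close> is injective, and by Baire's theorem some such ball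
  catches \<open>\<phi>\<close> on an open set.  There \<open>\<phi>\<close> is \<open>\<Phi>\<close> composed with a differentiable map, and its tangent
  spaces lie in those of \<open>\<Phi>\<close>.

  Finally, for a 3-plane on which \<open>\<omega>\<close> vanishes the real Gram matrix of a basis is the Hermitian one,
  whose determinant is \<open>|\<Omega>|\<^sup>2\<close>.  If the imaginary part of \<open>\<Omega>\<close> vanishes as well, then the real part is
  plus or minus the volume, and it has no zeros on an immersed piece; its sign is therefore the
  continuous orientation that is required.
\<close>

section \<open>Immersed pieces of a parametrized set\<close>

text \<open>Baire's theorem in the form in which it selects one member of a countable closed cover.\<close>

lemma countable_closed_cover_interior:
  fixes V :: "'a::{real_normed_vector,heine_borel} set"
  assumes "open V" "V \<noteq> {}" "V \<subseteq> \<Union>\<C>" "countable \<C>"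
    and closed: "\<And>A. A \<in> \<C> \<Longrightarrow> closed A"
  obtains A where "A \<in> \<C>" "interior A \<noteq> {}"
proof (rule ccontr)
  assume "\<not> thesis"
  with that have empty: "interior A = {}" if "A \<in> \<C>" for A
    using \<open>A \<in> \<C>\<close> by blast
  have "UNIV \<subseteq> closure (\<Inter>(uminus ` \<C>))"
  proof (rule Baire)
    show "openin (top_of_set UNIV) T \<and> UNIV \<subseteq> closure T" if "T \<in> uminus ` \<C>" for T
      using that closed empty by (auto simp: closure_complement)
  qed (use \<open>countable \<C>\<close> in auto)
  then have "interior (\<Union>\<C>) = {}"
    using closure_complement[of "\<Union>\<C>"] by (auto simp: uminus_Sup)
  then show False
    using assms(1-3) interior_maximal by blast
qed

text \<open>The reason is \<open>h \<bullet> L\<^sup>* (L h) = |L h|\<^sup>2\<close>.  The adjoint will serve as a coordinate map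
  for the image of \<open>L\<close>, and its composition with \<open>L\<close> is the Gram matrix of the images of the axes.\<close>

lemma linear_inj_adjoint_comp:
  fixes L :: "'a::euclidean_space \<Rightarrow> 'b::euclidean_space"
  assumes "linear L" "inj L"
  shows "linear (adjoint L \<circ> L)" "inj (adjoint L \<circ> L)"
proof -
  show lin: "linear (adjoint L \<circ> L)"
    by (intro linear_compose adjoint_linear assms)
  have "h = 0" if "adjoint L (L h) = 0" for h
  proof -
    have "L h \<bullet> L h = 0"
      using that adjoint_works[OF assms(1), of h "L h"] by simp
    then have "L h = L 0"
      by (simp add: linear_0[OF assms(1)])
    then show "h = 0"
      by (rule injD[OF assms(2)])
  qed
  then show "inj (adjoint L \<circ> L)"
    using linear_injective_0[OF lin] by simp
qed

lemma inj_endo_blinfun_left_inverse: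
  fixes A :: "'a::euclidean_space \<Rightarrow>\<^sub>L 'a"
  assumes "inj (blinfun_apply A)"
  obtains B where "B o\<^sub>L A = id_blinfun"
proof -
  obtain g where g: "linear g" "g \<circ> blinfun_apply A = id"
    using linear_injective_left_inverse[OF _ assms] bounded_linear.linear[OF blinfun.bounded_linear_right]
    by blast
  have "Blinfun g o\<^sub>L A = id_blinfun"
    using g by (auto intro!: blinfun_eqI simp: bounded_linear_Blinfun_apply linear_conv_bounded_linear fun_eq_iff)
  then show thesis using that by blast
qed

text \<open>The part of the inverse function theorem that is needed at regular points of the projected
  parametrization.  The radius also serves to show that the regular points form an open set.\<close>

lemma inj_on_cball_of_inj_derivative:
  fixes f :: "'a::euclidean_space \<Rightarrow> 'a"
  assumes "\<And>x. (f has_derivative blinfun_apply (f' x)) (at x)" "continuous_on UNIV f'"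
    and "inj (blinfun_apply (f' x0))"
  obtains e where "e > 0" "inj_on f (cball x0 e)"
    "\<And>x. x \<in> cball x0 e \<Longrightarrow> inj (blinfun_apply (f' x))"
proof -
  obtain B where B: "B o\<^sub>L f' x0 = id_blinfun"
    using inj_endo_blinfun_left_inverse[OF assms(3)] .
  obtain U V g g' where U: "open U" "x0 \<in> U" and hom: "homeomorphism U V f g"
    and bij: "\<And>y. y \<in> V \<Longrightarrow> bij (blinfun_apply (f' (g y)))"
    by (rule inverse_function_theorem[OF open_UNIV assms(1,2) UNIV_I B]) blast
  obtain e where e: "e > 0" "cball x0 e \<subseteq> U"
    using U open_contains_cball by blast
  have "g (f x) = x" if "x \<in> U" for x
    using hom that by (auto simp: homeomorphism_def)
  moreover have "f x \<in> V" if "x \<in> U" for x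
    using hom that by (auto simp: homeomorphism_def)
  ultimately show thesis
    using e bij by (intro that[of e]) (metis bij_is_inj inj_on_def subsetD)+
qed

text \<open>Applied to the restrictions of \<open>\<phi>\<close> to small open sets, this shows that at a dense set of
  parameters the tangent space of \<open>\<phi>\<close> is contained in one of \<open>\<Phi>\<close>.  It is an existence statement
  because at individual points it can fail, for instance over critical values of \<open>\<Phi>\<close>.\<close>

lemma immersed_piece_tangent:
  fixes \<Phi> :: "real^'n::{finite,wellorder} \<Rightarrow> 'b::euclidean_space" and \<phi> :: "real^'n::_ \<Rightarrow> 'b"
  assumes \<Phi>: "\<And>z. (\<Phi> has_derivative blinfun_apply (\<Phi>' z)) (at z)" "continuous_on UNIV \<Phi>'"
    and \<phi>: "\<And>x. x \<in> U \<Longrightarrow> (\<phi> has_derivative blinfun_apply (\<phi>' x)) (at x)" "continuous_on U \<phi>'"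
    and U: "open U" "x0 \<in> U" and inj: "inj (blinfun_apply (\<phi>' x0))"
    and sub: "\<phi> ` U \<subseteq> range \<Phi>"
  obtains x z where "x \<in> U" "range (blinfun_apply (\<phi>' x)) \<subseteq> range (blinfun_apply (\<Phi>' z))"
proof -
  \<comment> \<open>In the coordinates of the tangent space at \<open>x0\<close> the map \<open>\<phi>\<close> becomes the local diffeomorphism
    \<open>T \<circ> \<phi>\<close> with inverse \<open>h\<close>, and \<open>\<Phi>\<close> becomes the map \<open>\<Psi>\<close> between spaces of equal dimension.\<close>
  define T where "T = adjoint (blinfun_apply (\<phi>' x0))"
  have lin0: "linear (blinfun_apply (\<phi>' x0))"
    by (simp add: bounded_linear.linear blinfun.bounded_linear_right)
  have T: "bounded_linear T"
    using adjoint_linear[OF lin0] by (simp add: T_def linear_conv_bounded_linear)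
  define \<Psi> where "\<Psi> = T \<circ> \<Phi>"
  define \<Psi>' where "\<Psi>' z = Blinfun T o\<^sub>L \<Phi>' z" for z
  have T_app [simp]: "blinfun_apply (Blinfun T) = T"
    using T by (rule bounded_linear_Blinfun_apply)
  have comp: "blinfun_apply (Blinfun T o\<^sub>L L) = (\<lambda>v. T (blinfun_apply L v))" for L :: "(real^'n::_) \<Rightarrow>\<^sub>L 'b"
    by (simp add: fun_eq_iff)
  have \<Psi>: "(\<Psi> has_derivative blinfun_apply (\<Psi>' z)) (at z)" for z
    using bounded_linear.has_derivative[OF T \<Phi>(1)[of z]]
    by (simp add: \<Psi>_def \<Psi>'_def o_def comp)
  have cont_\<Psi>: "continuous_on UNIV \<Psi>'"
    unfolding \<Psi>'_def by (intro continuous_intros \<Phi>(2))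
  have cont\<Psi>: "continuous_on A \<Psi>" for A
    by (meson \<Psi> continuous_at_imp_continuous_on has_derivative_continuous)
  have cont\<Phi>: "continuous_on A \<Phi>" for A
    by (meson \<Phi> continuous_at_imp_continuous_on has_derivative_continuous)
  have g: "(T \<circ> \<phi> has_derivative blinfun_apply (Blinfun T o\<^sub>L \<phi>' x)) (at x)" if "x \<in> U" for x
    using bounded_linear.has_derivative[OF T \<phi>(1)[OF that]]
    by (simp add: o_def comp)
  have cont_g: "continuous_on U (\<lambda>x. Blinfun T o\<^sub>L \<phi>' x)"
    by (intro continuous_intros \<phi>(2))
  have "inj (blinfun_apply (Blinfun T o\<^sub>L \<phi>' x0))"
    using linear_inj_adjoint_comp(2)[OF lin0 inj, folded T_def] by (simp add: comp o_def)
  then obtain B where B: "B o\<^sub>L (Blinfun T o\<^sub>L \<phi>' x0) = id_blinfun"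
    using inj_endo_blinfun_left_inverse by blast
  obtain U' V h h' where U': "open U'" "U' \<subseteq> U" "x0 \<in> U'" and V: "open V" "(T \<circ> \<phi>) x0 \<in> V"
    and hom: "homeomorphism U' V (T \<circ> \<phi>) h"
    and h: "\<And>y. y \<in> V \<Longrightarrow> (h has_derivative (h' y)) (at y)"
    and h': "\<And>y. y \<in> V \<Longrightarrow> h' y = inv (blinfun_apply (Blinfun T o\<^sub>L \<phi>' (h y)))"
    and bij: "\<And>y. y \<in> V \<Longrightarrow> bij (blinfun_apply (Blinfun T o\<^sub>L \<phi>' (h y)))"
    by (rule inverse_function_theorem[OF U(1) g cont_g U(2) B], assumption) (rule that; simp)
  have hV: "h y \<in> U" "T (\<phi> (h y)) = y" if "y \<in> V" for y
    using hom that U'(2) by (auto simp: homeomorphism_def)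
  have cont_\<phi>h: "continuous_on V (\<phi> \<circ> h)"
  proof -
    have "continuous_on V h" using hom by (simp add: homeomorphism_def)
    moreover have "continuous_on (h ` V) \<phi>"
      using has_derivative_continuous[OF \<phi>(1)] hV(1) by (auto intro!: continuous_at_imp_continuous_on)
    ultimately show ?thesis by (rule continuous_on_compose)
  qed
  obtain e where e: "e > 0" "cball ((T \<circ> \<phi>) x0) e \<subseteq> V"
    using V open_contains_cball by blast
  \<comment> \<open>The closed sets for Baire's theorem: the \<open>D n\<close> exhaust the critical values of \<open>\<Psi>\<close>, and \<open>A z\<close> below
    consists of the points that \<open>\<phi> \<circ> h\<close> maps into the image of one closed ball of regular points.\<close>
  define S where "S = cball ((T \<circ> \<phi>) x0) e"
  define Z where "Z = {z. \<not> inj (blinfun_apply (\<Psi>' z))}"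
  define D where "D n = \<Psi> ` (Z \<inter> cball 0 (real n))" for n
  have "\<exists>r>0. inj_on \<Psi> (cball z r) \<and> cball z r \<inter> Z = {}" if "z \<notin> Z" for z
  proof -
    have "inj (blinfun_apply (\<Psi>' z))" using that by (simp add: Z_def)
    from inj_on_cball_of_inj_derivative[OF \<Psi> cont_\<Psi> this]
    obtain r where "r > 0" "inj_on \<Psi> (cball z r)"
      "\<And>x. x \<in> cball z r \<Longrightarrow> inj (blinfun_apply (\<Psi>' x))" by blast
    then show ?thesis by (auto simp: Z_def)
  qed
  then obtain r where r: "\<And>z. z \<notin> Z \<Longrightarrow> r z > 0 \<and> inj_on \<Psi> (cball z (r z)) \<and> cball z (r z) \<inter> Z = {}"
    by metis
  have "open (- Z)"
    unfolding open_contains_cball using r by blast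
  then have "closed Z" by (simp add: closed_def)
  obtain \<G> where \<G>: "\<G> \<subseteq> (\<lambda>z. ball z (r z)) ` (- Z)" "countable \<G>" "\<Union>\<G> = \<Union>((\<lambda>z. ball z (r z)) ` (- Z))"
    by (rule Lindelof[of "(\<lambda>z. ball z (r z)) ` (- Z)"]) auto
  then obtain I where I: "I \<subseteq> - Z" "countable I" "\<G> = (\<lambda>z. ball z (r z)) ` I"
    using countable_subset_image[of \<G> "\<lambda>z. ball z (r z)" "- Z"] by blast
  have cover: "- Z \<subseteq> (\<Union>z\<in>I. cball z (r z))"
  proof
    fix z assume "z \<in> - Z"
    then have "z \<in> ball z (r z)" using r[of z] by simp
    then have "z \<in> \<Union>\<G>" unfolding \<G>(3) using \<open>z \<in> - Z\<close> by blast
    then show "z \<in> (\<Union>z\<in>I. cball z (r z))" unfolding I(3) by fastforce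
  qed
  define A where "A z = S \<inter> (\<phi> \<circ> h) -` (\<Phi> ` cball z (r z))" for z
  have clA: "closed (A z)" for z
    unfolding A_def
  proof (rule continuous_closed_preimage)
    show "continuous_on S (\<phi> \<circ> h)"
      using cont_\<phi>h e(2) continuous_on_subset by (auto simp: S_def)
    show "closed (\<Phi> ` cball z (r z))"
      by (intro compact_imp_closed compact_continuous_image cont\<Phi> compact_cball)
  qed (simp add: S_def)
  have clD: "closed (D n)" for n
    unfolding D_def
    by (rule compact_imp_closed, rule compact_continuous_image[OF cont\<Psi>],
        rule closed_Int_compact[OF \<open>closed Z\<close> compact_cball])
  have intD: "interior (D n) = {}" for n
  proof -
    have "negligible (D n)"
      unfolding D_def
    proof (rule baby_Sard)
      show "(\<Psi> has_derivative blinfun_apply (\<Psi>' z)) (at z within Z \<inter> cball 0 (real n))" for z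
        using \<Psi> has_derivative_at_withinI by blast
      show "rank (matrix (blinfun_apply (\<Psi>' z))) < CARD('n)" if "z \<in> Z \<inter> cball 0 (real n)" for z
      proof -
        have "linear (blinfun_apply (\<Psi>' z))"
          by (simp add: bounded_linear.linear blinfun.bounded_linear_right)
        then have "(*v) (matrix (blinfun_apply (\<Psi>' z))) = blinfun_apply (\<Psi>' z)"
          by (simp add: fun_eq_iff matrix_works)
        then show ?thesis
          using that by (simp add: less_rank_noninjective Z_def)
      qed
    qed simp
    then show ?thesis
      using open_not_negligible negligible_subset interior_subset open_interior by metis
  qed
  have "ball ((T \<circ> \<phi>) x0) e \<subseteq> \<Union>(range D \<union> A ` I)"
  proof
    fix y assume "y \<in> ball ((T \<circ> \<phi>) x0) e"
    then have y: "y \<in> S" "y \<in> V" using e by (auto simp: S_def)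
    then obtain z where z: "\<phi> (h y) = \<Phi> z" using sub hV(1) by blast
    then have \<Psi>z: "\<Psi> z = y" using hV(2)[OF y(2)] by (simp add: \<Psi>_def)
    show "y \<in> \<Union>(range D \<union> A ` I)"
    proof (cases "z \<in> Z")
      case True
      then have "y \<in> D (nat \<lceil>norm z\<rceil>)"
        using \<Psi>z real_nat_ceiling_ge[of "norm z"] by (auto simp: D_def)
      then show ?thesis by blast
    next
      case False
      then obtain i where "i \<in> I" "z \<in> cball i (r i)" using cover by blast
      then have "y \<in> A i" using y z by (auto simp del: mem_cball simp: A_def)
      then show ?thesis using \<open>i \<in> I\<close> by blast
    qed
  qed
  then obtain C where C: "C \<in> range D \<union> A ` I" "interior C \<noteq> {}"
    by (rule countable_closed_cover_interior[rotated 2]) (use e I(2) clA clD in auto)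
  then obtain i where i: "i \<in> I" "interior (A i) \<noteq> {}" using intD by auto
  \<comment> \<open>On \<open>Q\<close> the local inverse \<open>k\<close> of \<open>\<Psi>\<close> lifts \<open>\<phi> \<circ> h\<close> through \<open>\<Phi>\<close>: a value of \<open>\<phi> \<circ> h\<close> determines its
    projection, which determines the point of \<open>K\<close> over it.\<close>
  define Q where "Q = interior (A i)"
  define K where "K = cball i (r i)"
  have K: "compact K" "inj_on \<Psi> K" "K \<inter> Z = {}"
    using r[of i] i(1) I(1) by (auto simp: K_def)
  define k where "k = the_inv_into K \<Psi>"
  have k: "k (\<Psi> z) = z" if "z \<in> K" for z
    using that K by (simp add: k_def the_inv_into_f_f)
  have Q: "y \<in> V \<and> k y \<in> K \<and> \<Psi> (k y) = y \<and> \<Phi> (k y) = \<phi> (h y)" if "y \<in> Q" for y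
  proof -
    have "y \<in> A i" using that interior_subset by (auto simp: Q_def)
    then obtain z where z: "z \<in> K" "\<phi> (h y) = \<Phi> z" and y: "y \<in> V"
      using e by (auto simp: A_def K_def S_def)
    then have "\<Psi> z = y" using hV(2)[OF y] by (simp add: \<Psi>_def)
    then show ?thesis using z y k by auto
  qed
  obtain y where y: "y \<in> Q" using i by (auto simp: Q_def)
  define z where "z = k y"
  have z: "z \<in> K" "\<Psi> z = y" using Q[OF y] by (auto simp: z_def)
  then have "inj (blinfun_apply (\<Psi>' z))" using K(3) by (auto simp: Z_def)
  then obtain G where G: "G o\<^sub>L \<Psi>' z = id_blinfun"
    using inj_endo_blinfun_left_inverse by blast
  have dk: "(k has_derivative blinfun_apply G) (at y)"
    unfolding z(2)[symmetric]
  proof (rule has_derivative_inverse[OF K(1) z(1) _ cont\<Psi> k \<Psi>])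
    have "Q \<subseteq> \<Psi> ` K" using Q by (metis image_eqI subsetI)
    then show "\<Psi> z \<in> interior (\<Psi> ` K)"
      using y z(2) by (auto simp: Q_def intro: interior_maximal[THEN subsetD])
    show "blinfun_apply G \<circ> blinfun_apply (\<Psi>' z) = id"
      by (rule ext) (simp add: G flip: blinfun_apply_blinfun_compose)
  qed (auto simp: blinfun.bounded_linear_right)
  have "(\<Phi> \<circ> k has_derivative \<Phi>' z \<circ> blinfun_apply G) (at y)"
    using diff_chain_at[OF dk \<Phi>(1)] by (simp add: z_def)
  moreover have "(\<phi> \<circ> h has_derivative \<phi>' (h y) \<circ> h' y) (at y)"
    using Q[OF y] hV(1) by (intro diff_chain_at h \<phi>(1)) auto
  then have "(\<Phi> \<circ> k has_derivative \<phi>' (h y) \<circ> h' y) (at y)"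
    by (rule has_derivative_transform_within_open[of _ _ _ _ Q]) (use y Q in \<open>auto simp: Q_def\<close>)
  ultimately have eq: "\<Phi>' z \<circ> blinfun_apply G = \<phi>' (h y) \<circ> h' y"
    by (rule has_derivative_unique)
  have "surj (h' y)"
    using h'[of y] bij_is_surj[OF bij_imp_bij_inv[OF bij[of y]]] Q[OF y] by simp
  then have "range (blinfun_apply (\<phi>' (h y))) = range (\<phi>' (h y) \<circ> h' y)"
    by (metis image_comp)
  also have "\<dots> \<subseteq> range (blinfun_apply (\<Phi>' z))"
    unfolding eq[symmetric] by auto
  finally show thesis using that[of "h y" z] hV(1) Q[OF y] by blast
qed

section \<open>Planes on which the Kaehler form and the imaginary part of the volume form vanish\<close>

text \<open>The standard Hermitian form; its real part is the Euclidean inner product and its imaginary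
  part is the Kaehler form up to sign.\<close>

definition herm :: "complex^'n \<Rightarrow> complex^'n \<Rightarrow> complex" where
  "herm u v = (\<Sum>k\<in>UNIV. u $ k * cnj (v $ k))"

lemma Re_herm: "Re (herm u v) = u \<bullet> v"
  by (simp add: herm_def inner_vec_def inner_complex_def)

lemma herm_add_left: "herm (u + v) w = herm u w + herm v w"
  by (simp add: herm_def algebra_simps sum.distrib)

lemma herm_add_right: "herm u (v + w) = herm u v + herm u w"
  by (simp add: herm_def algebra_simps sum.distrib)

lemma herm_scaleR_left: "herm (r *\<^sub>R u) v = of_real r * herm u v"
  unfolding herm_def sum_distrib_left
  by (rule sum.cong) (simp_all add: scaleR_conv_of_real[where 'a=complex])

lemma herm_scaleR_right: "herm u (r *\<^sub>R v) = of_real r * herm u v"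
  unfolding herm_def sum_distrib_left
  by (rule sum.cong) (simp_all add: scaleR_conv_of_real[where 'a=complex])

lemma cnj_herm: "cnj (herm u v) = herm v u"
  by (simp add: herm_def mult.commute)

text \<open>The predicate is meant for real subspaces and refers to all of their vectors, so that it passes
  to subsets and each of its conditions is preserved under limits.\<close>

definition special_isotropic :: "(complex^3) set \<Rightarrow> bool" where
  "special_isotropic P \<longleftrightarrow>
     (\<forall>u\<in>P. \<forall>v\<in>P. Im (herm u v) = 0) \<and> (\<forall>u\<in>P. \<forall>v\<in>P. \<forall>w\<in>P. Im (Omega u v w) = 0)"

lemma special_isotropic_subset: "special_isotropic P \<Longrightarrow> Q \<subseteq> P \<Longrightarrow> special_isotropic Q"
  unfolding special_isotropic_def by blast

lemma Omega_linear_combination: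
  fixes a :: "3 \<Rightarrow> complex^3" and k :: "real^3^3"
  shows "Omega (\<Sum>j\<in>UNIV. k$1$j *\<^sub>R a j) (\<Sum>j\<in>UNIV. k$2$j *\<^sub>R a j) (\<Sum>j\<in>UNIV. k$3$j *\<^sub>R a j) =
    of_real (det k) * Omega (a 1) (a 2) (a 3)"
proof -
  let ?K = "(\<chi> i j. of_real (k$i$j)) :: complex^3^3"
  have "vector [\<Sum>j\<in>UNIV. k$1$j *\<^sub>R a j, \<Sum>j\<in>UNIV. k$2$j *\<^sub>R a j, \<Sum>j\<in>UNIV. k$3$j *\<^sub>R a j]
      = ?K ** vector [a 1, a 2, a 3]"
    by (simp add: vec_eq_iff forall_3 sum_3 matrix_matrix_mult_def scaleR_conv_of_real[where 'a=complex])
  moreover have "det ?K = of_real (det k)"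
    by (simp add: det_3)
  ultimately show ?thesis
    by (simp add: Omega_def det_mul)
qed

lemma special_isotropic_range:
  fixes L :: "real^3 \<Rightarrow> complex^3"
  assumes "linear L"
    and herm: "\<And>i j. Im (herm (L (axis i 1)) (L (axis j 1))) = 0"
    and Omega: "Im (Omega (L (axis 1 1)) (L (axis 2 1)) (L (axis 3 1))) = 0"
  shows "special_isotropic (range L)"
proof -
  have L: "L h = (\<Sum>j\<in>UNIV. h$j *\<^sub>R L (axis j 1))" for h
  proof -
    have "L h = L (\<Sum>j\<in>UNIV. h$j *\<^sub>R axis j 1)"
      using basis_expansion[of h] by (simp add: scalar_mult_eq_scaleR)
    then show ?thesis
      by (simp only: linear_sum[OF assms(1)] linear_scale[OF assms(1)])
  qed
  have "Im (herm (L g) (L h)) = 0" for g h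
    by (subst L[of g], subst L[of h])
       (simp add: sum_3 herm herm_add_left herm_add_right herm_scaleR_left herm_scaleR_right)
  moreover have "Im (Omega (L f) (L g) (L h)) = 0" for f g h
    using Omega Omega_linear_combination[of "vector [f, g, h]" "\<lambda>j. L (axis j 1)"]
    by (simp flip: L)
  ultimately show ?thesis
    by (auto simp: special_isotropic_def)
qed

text \<open>The Gram matrix is the matrix of \<open>L\<^sup>* L\<close>, which is injective.\<close>

lemma det_gram_nonzero:
  fixes L :: "real^'n::finite \<Rightarrow> 'b::euclidean_space"
  assumes "linear L" "inj L"
  shows "det (\<chi> i j. L (axis i 1) \<bullet> L (axis j 1)) \<noteq> 0"
proof -
  have "(\<chi> i j. L (axis i 1) \<bullet> L (axis j 1)) = matrix (adjoint L \<circ> L)"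
  proof (simp add: vec_eq_iff matrix_def, intro allI)
    fix i j
    have "L (axis i 1) \<bullet> L (axis j 1) = axis i 1 \<bullet> adjoint L (L (axis j 1))"
      by (simp add: adjoint_works[OF assms(1)])
    then show "L (axis i 1) \<bullet> L (axis j 1) = adjoint L (L (axis j 1)) $ i"
      by (simp add: inner_axis')
  qed
  then show ?thesis
    using det_nz_iff_inj[OF linear_inj_adjoint_comp(1)[OF assms]] linear_inj_adjoint_comp(2)[OF assms] by simp
qed

text \<open>Where the Kaehler form vanishes, the real Gram matrix is \<open>M M\<^sup>*\<close> for the complex matrix \<open>M\<close> with
  the given rows, and its determinant factors.\<close>

lemma det_gram_eq_norm_Omega:
  assumes "\<And>x y. x \<in> {u, v, w} \<Longrightarrow> y \<in> {u, v, w} \<Longrightarrow> Im (herm x y) = 0"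
  shows "det (\<chi> i j. (vector [u, v, w] :: (complex^3)^3) $ i \<bullet> (vector [u, v, w] :: (complex^3)^3) $ j)
    = (cmod (Omega u v w))\<^sup>2"
proof -
  let ?M = "vector [u, v, w] :: complex^3^3"
  let ?C = "(\<chi> i j. cnj (?M $ j $ i)) :: complex^3^3"
  let ?G = "(\<chi> i j. ?M $ i \<bullet> ?M $ j) :: real^3^3"
  have "?M $ i \<in> {u, v, w}" for i
    using exhaust_3[of i] by auto
  then have "herm (?M $ i) (?M $ j) = of_real (?G $ i $ j)" for i j
    using assms by (simp add: complex_eq_iff Re_herm)
  then have "?M ** ?C = (\<chi> i j. of_real (?G $ i $ j))"
    by (simp add: vec_eq_iff matrix_matrix_mult_def herm_def)
  then have "det ?M * det ?C = det ((\<chi> i j. of_real (?G $ i $ j)) :: complex^3^3)"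
    by (simp only: det_mul[symmetric])
  moreover have "det ?C = cnj (det ?M)"
    by (simp add: det_3 algebra_simps)
  moreover have "det ((\<chi> i j. of_real (?G $ i $ j)) :: complex^3^3) = of_real (det ?G)"
    by (simp add: det_3)
  ultimately have "complex_of_real (det ?G) = of_real ((cmod (Omega u v w))\<^sup>2)"
    unfolding Omega_def complex_norm_square by simp
  then show ?thesis
    by (simp only: of_real_eq_iff)
qed

lemma Omega_calibrated_up_to_sign:
  fixes L :: "real^3 \<Rightarrow> complex^3"
  assumes "linear L" "inj L" "special_isotropic (range L)"
  shows "vol3 (L (axis 1 1)) (L (axis 2 1)) (L (axis 3 1))
      = \<bar>Re (Omega (L (axis 1 1)) (L (axis 2 1)) (L (axis 3 1)))\<bar>"
    and "Re (Omega (L (axis 1 1)) (L (axis 2 1)) (L (axis 3 1))) \<noteq> 0"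
proof -
  define u v w where uvw: "u = L (axis 1 1)" "v = L (axis 2 1)" "w = L (axis 3 1)"
  let ?g = "det (\<chi> i j. (vector [u, v, w] :: (complex^3)^3) $ i \<bullet> (vector [u, v, w] :: (complex^3)^3) $ j)"
  have "Im (Omega u v w) = 0"
    using assms(3) by (simp add: special_isotropic_def uvw)
  moreover have "?g = (cmod (Omega u v w))\<^sup>2"
    using assms(3) by (intro det_gram_eq_norm_Omega) (auto simp: special_isotropic_def uvw)
  ultimately have g: "?g = (Re (Omega u v w))\<^sup>2"
    by (simp add: cmod_power2)
  then show "vol3 u v w = \<bar>Re (Omega u v w)\<bar>"
    by (simp add: vol3_def)
  have "?g = det (\<chi> i j. L (axis i 1) \<bullet> L (axis j 1))"
    by (simp add: det_3 uvw)
  then show "Re (Omega u v w) \<noteq> 0"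
    using g det_gram_nonzero[OF assms(1,2)] by auto
qed

lemma continuous_on_herm [continuous_intros]:
  "continuous_on S f \<Longrightarrow> continuous_on S g \<Longrightarrow> continuous_on S (\<lambda>x. herm (f x) (g x))"
  unfolding herm_def by (intro continuous_intros)

lemma continuous_on_Omega [continuous_intros]:
  "continuous_on S f \<Longrightarrow> continuous_on S g \<Longrightarrow> continuous_on S h \<Longrightarrow>
    continuous_on S (\<lambda>x. Omega (f x) (g x) (h x))"
  unfolding Omega_def det_3 vector_3 by (intro continuous_intros)

text \<open>The real part of the volume form has no zeros on the frames given by the derivative, so its sign
  is continuous and can be taken as the orientation.\<close>

lemma special_Lagrangian_immersion_if_isotropic:
  assumes imm: "C1_immersion U \<phi> \<phi>'"
    and iso: "\<And>x. x \<in> U \<Longrightarrow> special_isotropic (range (blinfun_apply (\<phi>' x)))"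
  shows "special_Lagrangian_immersion U \<phi> \<phi>'"
proof -
  define R where "R x = Re (Omega (\<phi>' x (axis 1 1)) (\<phi>' x (axis 2 1)) (\<phi>' x (axis 3 1)))" for x
  have lin: "linear (blinfun_apply (\<phi>' x))" for x
    by (simp add: bounded_linear.linear blinfun.bounded_linear_right)
  have inj: "inj (blinfun_apply (\<phi>' x))" if "x \<in> U" for x
    using imm that by (simp add: C1_immersion_def)
  have nz: "R x \<noteq> 0" if "x \<in> U" for x
    unfolding R_def using Omega_calibrated_up_to_sign(2)[OF lin inj iso] that by blast
  have "continuous_on U R"
    unfolding R_def using imm by (auto simp: C1_immersion_def intro!: continuous_intros)
  then have "continuous_on U (\<lambda>x. sgn (R x))"
    using nz by (intro continuous_intros) auto
  moreover have "R x = sgn (R x) * vol3 (\<phi>' x (axis 1 1)) (\<phi>' x (axis 2 1)) (\<phi>' x (axis 3 1))"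
    if "x \<in> U" for x
    using Omega_calibrated_up_to_sign(1)[OF lin inj iso, OF that that]
    by (simp add: R_def mult_sgn_abs)
  ultimately show ?thesis
    using imm nz unfolding special_Lagrangian_immersion_def R_def
    by (intro conjI exI[of _ "\<lambda>x. sgn (R x)"]) (auto simp: sgn_if R_def)
qed


text \<open>For fixed vectors, each condition in \<open>special_isotropic\<close> says that a continuous function of the
  parameter vanishes.  The set where it does not vanish is open, and if it were nonempty then
  \<open>immersed_piece_tangent\<close> would give a point of it with an isotropic tangent space.\<close>

lemma special_Lagrangian_range:
  fixes \<Phi> :: "real^3 \<Rightarrow> complex^3"
  assumes \<Phi>: "\<And>z. (\<Phi> has_derivative blinfun_apply (\<Phi>' z)) (at z)" "continuous_on UNIV \<Phi>'"
    and iso: "\<And>z. special_isotropic (range (blinfun_apply (\<Phi>' z)))"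
  shows "special_Lagrangian_where_nonsingular (range \<Phi>)"
  unfolding special_Lagrangian_where_nonsingular_def
proof (intro allI impI, elim conjE)
  fix U \<phi> \<phi>'
  assume imm: "C1_immersion U \<phi> \<phi>'" and sub: "\<phi> ` U \<subseteq> range \<Phi>"
  have U: "open U" "continuous_on U \<phi>'"
    and der: "\<And>x. x \<in> U \<Longrightarrow> (\<phi> has_derivative blinfun_apply (\<phi>' x)) (at x)"
    and inj: "\<And>x. x \<in> U \<Longrightarrow> inj (blinfun_apply (\<phi>' x))"
    using imm by (auto simp: C1_immersion_def)
  have dense: "\<exists>x\<in>S. special_isotropic (range (blinfun_apply (\<phi>' x)))"
    if S: "open S" "S \<subseteq> U" "S \<noteq> {}" for S
  proof -
    obtain x0 where x0: "x0 \<in> S" using S(3) by blast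
    have "continuous_on S \<phi>'" "\<phi> ` S \<subseteq> range \<Phi>"
      using U(2) S(2) sub continuous_on_subset by blast+
    then obtain x z where "x \<in> S" "range (blinfun_apply (\<phi>' x)) \<subseteq> range (blinfun_apply (\<Phi>' z))"
      using x0 S der inj by (elim immersed_piece_tangent[OF \<Phi>, rotated -1]) auto
    then show ?thesis
      using iso special_isotropic_subset by blast
  qed
  have vanish: "F x = 0"
    if F: "continuous_on U F" "\<And>y. special_isotropic (range (blinfun_apply (\<phi>' y))) \<Longrightarrow> F y = 0"
      and x: "x \<in> U" for F :: "real^3 \<Rightarrow> real" and x
  proof (rule ccontr)
    assume "F x \<noteq> 0"
    define S where "S = U \<inter> F -` (- {0})"
    have "open S"
      unfolding S_def by (rule continuous_open_preimage[OF F(1) U(1)]) auto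
    moreover have "x \<in> S" using \<open>F x \<noteq> 0\<close> x by (simp add: S_def)
    ultimately obtain y where "y \<in> S" "special_isotropic (range (blinfun_apply (\<phi>' y)))"
      using dense[of S] by (auto simp: S_def)
    then show False using F(2) by (simp add: S_def)
  qed
  have "special_isotropic (range (blinfun_apply (\<phi>' x)))" if "x \<in> U" for x
    unfolding special_isotropic_def
  proof (safe; (rule vanish[OF _ _ that])?)
    show "continuous_on U (\<lambda>x. Im (herm (\<phi>' x g) (\<phi>' x h)))"
      and "continuous_on U (\<lambda>x. Im (Omega (\<phi>' x f) (\<phi>' x g) (\<phi>' x h)))" for f g h
      using U(2) by (auto intro!: continuous_intros)
  qed (auto simp: special_isotropic_def)
  then show "special_Lagrangian_immersion U \<phi> \<phi>'"
    by (rule special_Lagrangian_immersion_if_isotropic[OF imm])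
qed

section \<open>Evolving quadrics by the conjugate cross product\<close>

text \<open>The complex conjugate of the bilinear cross product; conjugation makes it orthogonal to its
  arguments for the Hermitian form rather than for the complex bilinear one.\<close>

definition ccross :: "complex^3 \<Rightarrow> complex^3 \<Rightarrow> complex^3" where
  "ccross a b = vector [cnj (a$2 * b$3 - a$3 * b$2), cnj (a$3 * b$1 - a$1 * b$3), cnj (a$1 * b$2 - a$2 * b$1)]"

lemma herm_ccross: "herm a (ccross a b) = 0" "herm b (ccross a b) = 0"
  by (simp_all add: herm_def ccross_def sum_3 algebra_simps)

lemma Omega_ccross: "Omega a b (ccross a b) = herm (ccross a b) (ccross a b)"
  by (simp add: Omega_def herm_def ccross_def sum_3 det_3 algebra_simps)

lemma Im_herm_self: "Im (herm u u) = 0"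
  using cnj_herm[of u u] by (simp add: complex_eq_iff)

text \<open>The third spanning vector meets all conditions that involve it because it is a real
  multiple of the conjugate cross product, so only the Kaehler form of the first two is left.\<close>

lemma special_isotropic_ccross:
  assumes "Im (herm a b) = 0"
  shows "special_isotropic (range (\<lambda>h::real^3. (h$1) *\<^sub>R a + (h$2) *\<^sub>R b + (h$3) *\<^sub>R (s *\<^sub>R ccross a b)))"
    (is "special_isotropic (range ?L)")
proof (rule special_isotropic_range)
  show "linear ?L"
    by (auto intro!: linearI simp: algebra_simps)
  have L: "?L (axis 1 1) = a" "?L (axis 2 1) = b" "?L (axis 3 1) = s *\<^sub>R ccross a b"
    by (simp_all add: axis_def)
  have "Im (herm b a) = 0"
    using assms cnj_herm[of a b] by (metis cnj.sel(2) neg_0_equal_iff_equal)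
  moreover have "herm (ccross a b) a = 0" "herm (ccross a b) b = 0"
    using cnj_herm[of a "ccross a b"] cnj_herm[of b "ccross a b"] by (simp_all add: herm_ccross)
  ultimately have "\<forall>i j. Im (herm (?L (axis i 1)) (?L (axis j 1))) = 0"
    unfolding forall_3 L
    by (simp add: herm_scaleR_left herm_scaleR_right herm_ccross Im_herm_self assms)
  then show "Im (herm (?L (axis i 1)) (?L (axis j 1))) = 0" for i j
    by blast
  have "Omega a b (s *\<^sub>R ccross a b) = of_real s * Omega a b (ccross a b)"
    by (simp add: Omega_def det_3 scaleR_conv_of_real[where 'a=complex] algebra_simps)
  then show "Im (Omega (?L (axis 1 1)) (?L (axis 2 1)) (?L (axis 3 1))) = 0"
    unfolding L by (simp add: Omega_ccross Im_herm_self)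
qed

lemma has_derivative_vec3I:
  fixes f :: "'a::real_normed_vector \<Rightarrow> complex^3"
  assumes "((\<lambda>x. f x $ 1) has_derivative (\<lambda>h. f' h $ 1)) (at x)"
    and "((\<lambda>x. f x $ 2) has_derivative (\<lambda>h. f' h $ 2)) (at x)"
    and "((\<lambda>x. f x $ 3) has_derivative (\<lambda>h. f' h $ 3)) (at x)"
  shows "(f has_derivative f') (at x)"
proof (subst has_derivative_componentwise_within, rule ballI)
  fix e :: "complex^3" assume "e \<in> Basis"
  then obtain i d where e: "e = axis i d" by (auto simp: Basis_vec_def)
  have "((\<lambda>x. f x $ i) has_derivative (\<lambda>h. f' h $ i)) (at x)"
    using assms exhaust_3[of i] by auto
  then show "((\<lambda>x. f x \<bullet> e) has_derivative (\<lambda>h. f' h \<bullet> e)) (at x)"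
    unfolding e inner_axis by (rule has_derivative_inner_left)
qed

lemma continuous_on_vec3I:
  fixes f :: "'a::topological_space \<Rightarrow> 'b::topological_space^3"
  assumes "continuous_on S (\<lambda>x. f x $ 1)" "continuous_on S (\<lambda>x. f x $ 2)" "continuous_on S (\<lambda>x. f x $ 3)"
  shows "continuous_on S f"
proof -
  have "continuous_on S (\<lambda>x. \<chi> i. f x $ i)"
    using assms exhaust_3 by (intro continuous_on_vec_lambda) metis
  then show ?thesis by simp
qed

text \<open>The coefficients in \<open>y\<^sub>1, y\<^sub>2\<close> of the equation \<open>\<partial>\<Phi>/\<partial>t = (\<partial>\<Phi>/\<partial>y\<^sub>1 \<times> \<partial>\<Phi>/\<partial>y\<^sub>2)/2\<close>, with the conjugate
  cross product on the right, for a map \<open>\<Phi>\<close> that is quadratic in \<open>y\<^sub>1, y\<^sub>2\<close> with quadratic part of the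
  form \<open>((y\<^sub>1\<^sup>2 + y\<^sub>2\<^sup>2) u\<^sub>1/2, (y\<^sub>1\<^sup>2 - y\<^sub>2\<^sup>2) u\<^sub>2/2, y\<^sub>1 y\<^sub>2 u\<^sub>3)\<close>.  The quadratic coefficients evolve by
  themselves, the linear ones by a system that is linear over the reals, and the constant ones by
  integration.  The third component of the coefficient of \<open>y\<^sub>1\<close> is called \<open>q\<^sub>3\<close>, and that of \<open>y\<^sub>2\<close> is
  called \<open>p\<^sub>3\<close>; with this naming the linear system splits into the same system for \<open>p\<close> and for \<open>q\<close>.\<close>

locale quadric_evolution =
  fixes u1 u2 u3 p1 p2 p3 q1 q2 q3 r1 r2 r3 :: "real \<Rightarrow> complex"
  assumes u1: "\<And>t. (u1 has_vector_derivative cnj (u2 t * u3 t)) (at t)"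
    and u2: "\<And>t. (u2 has_vector_derivative - cnj (u1 t * u3 t)) (at t)"
    and u3: "\<And>t. (u3 has_vector_derivative - cnj (u1 t * u2 t)) (at t)"
    and p1: "\<And>t. (p1 has_vector_derivative (1/2) * cnj (u2 t * p3 t + u3 t * p2 t)) (at t)"
    and p2: "\<And>t. (p2 has_vector_derivative - (1/2) * cnj (u1 t * p3 t + u3 t * p1 t)) (at t)"
    and p3: "\<And>t. (p3 has_vector_derivative - (1/2) * cnj (u1 t * p2 t + u2 t * p1 t)) (at t)"
    and q1: "\<And>t. (q1 has_vector_derivative (1/2) * cnj (u2 t * q3 t + u3 t * q2 t)) (at t)"
    and q2: "\<And>t. (q2 has_vector_derivative - (1/2) * cnj (u1 t * q3 t + u3 t * q1 t)) (at t)"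
    and q3: "\<And>t. (q3 has_vector_derivative - (1/2) * cnj (u1 t * q2 t + u2 t * q1 t)) (at t)"
    and r1: "\<And>t. (r1 has_vector_derivative (1/2) * cnj (p2 t * p3 t + q3 t * q2 t)) (at t)"
    and r2: "\<And>t. (r2 has_vector_derivative (1/2) * cnj (q3 t * q1 t - p1 t * p3 t)) (at t)"
    and r3: "\<And>t. (r3 has_vector_derivative - (1/2) * cnj (p1 t * q2 t + p2 t * q1 t)) (at t)"
begin

definition param :: "real \<Rightarrow> real \<Rightarrow> real \<Rightarrow> complex^3" where
  "param y1 y2 t = vector
     [of_real ((y1^2 + y2^2) / 2) * u1 t + of_real y1 * p1 t + of_real y2 * q1 t + r1 t,
      of_real ((y1^2 - y2^2) / 2) * u2 t + of_real y1 * p2 t - of_real y2 * q2 t + r2 t,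
      of_real (y1 * y2) * u3 t + of_real y1 * q3 t + of_real y2 * p3 t + r3 t]"

definition param_y1 :: "real \<Rightarrow> real \<Rightarrow> real \<Rightarrow> complex^3" where
  "param_y1 y1 y2 t = vector
     [of_real y1 * u1 t + p1 t, of_real y1 * u2 t + p2 t, of_real y2 * u3 t + q3 t]"

definition param_y2 :: "real \<Rightarrow> real \<Rightarrow> real \<Rightarrow> complex^3" where
  "param_y2 y1 y2 t = vector
     [of_real y2 * u1 t + q1 t, - of_real y2 * u2 t - q2 t, of_real y1 * u3 t + p3 t]"

lemma has_derivative_comp_nth3:
  assumes "(g has_vector_derivative g') (at (x$3))"
  shows "((\<lambda>x::real^3. g (x$3)) has_derivative (\<lambda>h. h$3 *\<^sub>R g')) (at x)"
  using has_derivative_compose[OF bounded_linear_imp_has_derivative[OF bounded_linear_vec_nth]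
      assms[unfolded has_vector_derivative_def]] .

lemmas curve_derivs = u1 u2 u3 p1 p2 p3 q1 q2 q3 r1 r2 r3

text \<open>The factor \<open>1/2\<close> and the cross product in the third partial derivative are the content of the
  evolution equations.\<close>

lemma param_has_derivative:
  fixes x :: "real^3"
  defines "a \<equiv> param_y1 (x$1) (x$2) (x$3)" and "b \<equiv> param_y2 (x$1) (x$2) (x$3)"
  shows "((\<lambda>x. param (x$1) (x$2) (x$3)) has_derivative
     (\<lambda>h. (h$1) *\<^sub>R a + (h$2) *\<^sub>R b + (h$3) *\<^sub>R ((1/2) *\<^sub>R ccross a b))) (at x)"
proof -
  note nth = bounded_linear_imp_has_derivative[OF bounded_linear_vec_nth]
  have comp: "((\<lambda>x. of_real (P x) * g (x$3)) has_derivative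
      (\<lambda>h. of_real (P x) * (h$3 *\<^sub>R g') + of_real (P' h) * g (x$3))) (at x)"
    if "(P has_derivative P') (at x)" "(g has_vector_derivative g') (at (x$3))"
    for P P' :: "real^3 \<Rightarrow> real" and g and g' :: complex
    by (rule has_derivative_mult[OF has_derivative_of_real[OF that(1)] has_derivative_comp_nth3[OF that(2)]])
  have sq: "((\<lambda>x::real^3. (x$i)^2 / 2) has_derivative (\<lambda>h. x$i * h$i)) (at x)" for i
    by (auto intro!: derivative_eq_intros nth)
  have plus: "((\<lambda>x::real^3. ((x$1)^2 + (x$2)^2) / 2) has_derivative (\<lambda>h. x$1 * h$1 + x$2 * h$2)) (at x)"
    and minus: "((\<lambda>x::real^3. ((x$1)^2 - (x$2)^2) / 2) has_derivative (\<lambda>h. x$1 * h$1 - x$2 * h$2)) (at x)"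
    and times: "((\<lambda>x::real^3. x$1 * x$2) has_derivative (\<lambda>h. x$1 * h$2 + h$1 * x$2)) (at x)"
    using has_derivative_add[OF sq[of 1] sq[of 2]] has_derivative_diff[OF sq[of 1] sq[of 2]]
      has_derivative_mult[OF nth[of 1] nth[of 2]]
    by (simp_all add: add_divide_distrib diff_divide_distrib)
  note expand = fun_eq_iff a_def b_def param_y1_def param_y2_def ccross_def
    scaleR_conv_of_real[where 'a=complex] algebra_simps power2_eq_square
  show ?thesis
    apply (rule has_derivative_vec3I;
        simp only: param_def vector_3 vector_add_component vector_scaleR_component;
        rule has_derivative_eq_rhs)
         apply (rule has_derivative_add comp[OF plus u1] comp[OF nth p1] comp[OF nth q1]
          r1[THEN has_derivative_comp_nth3])+
        apply (simp add: expand)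
       apply (rule has_derivative_add has_derivative_diff comp[OF minus u2] comp[OF nth p2] comp[OF nth q2]
        r2[THEN has_derivative_comp_nth3])+
      apply (simp add: expand diff_divide_distrib)
     apply (rule has_derivative_add comp[OF times u3] comp[OF nth p3] comp[OF nth q3]
      r3[THEN has_derivative_comp_nth3])+
    apply (simp add: expand)
    done
qed

lemma param_partials_continuous:
  shows "continuous_on UNIV (\<lambda>x::real^3. param_y1 (x$1) (x$2) (x$3))"
    and "continuous_on UNIV (\<lambda>x::real^3. param_y2 (x$1) (x$2) (x$3))"
proof -
  have "continuous_on UNIV (\<lambda>x::real^3. g (x$3))"
    if "\<And>t. (g has_vector_derivative g' t) (at t)" for g g' :: "real \<Rightarrow> complex"
    using has_derivative_continuous[OF has_derivative_comp_nth3[OF that]]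
    by (simp add: continuous_on_eq_continuous_within)
  note this[continuous_intros] = curve_derivs[THEN this]
  show "continuous_on UNIV (\<lambda>x::real^3. param_y1 (x$1) (x$2) (x$3))"
    "continuous_on UNIV (\<lambda>x::real^3. param_y2 (x$1) (x$2) (x$3))"
    by (rule continuous_on_vec3I; simp only: param_y1_def param_y2_def vector_3; intro continuous_intros)+
qed

lemma continuous_on_ccross:
  assumes "continuous_on S f" "continuous_on S g"
  shows "continuous_on S (\<lambda>x. ccross (f x) (g x))"
  by (rule continuous_on_vec3I; simp only: ccross_def vector_3; intro continuous_intros assms)

theorem special_Lagrangian_param:
  assumes "\<And>y1 y2 t. Im (herm (param_y1 y1 y2 t) (param_y2 y1 y2 t)) = 0"
  shows "special_Lagrangian_where_nonsingular {param y1 y2 t | t y1 y2. True}"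
proof -
  define a where "a x = param_y1 (x$1) (x$2) (x$3)" for x :: "real^3"
  define b where "b x = param_y2 (x$1) (x$2) (x$3)" for x :: "real^3"
  define L where "L x h = (h$1) *\<^sub>R a x + (h$2) *\<^sub>R b x + (h$3) *\<^sub>R ((1/2) *\<^sub>R ccross (a x) (b x))"
    for x h :: "real^3"
  have der: "((\<lambda>x. param (x$1) (x$2) (x$3)) has_derivative L x) (at x)" for x
    using param_has_derivative[of x] by (simp add: L_def[abs_def] a_def b_def)
  have L: "blinfun_apply (Blinfun (L x)) = L x" for x
    by (rule bounded_linear_Blinfun_apply[OF has_derivative_bounded_linear[OF der]])
  have "special_Lagrangian_where_nonsingular (range (\<lambda>x::real^3. param (x$1) (x$2) (x$3)))"
  proof (rule special_Lagrangian_range)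
    show "((\<lambda>x. param (x$1) (x$2) (x$3)) has_derivative blinfun_apply (Blinfun (L z))) (at z)" for z
      unfolding L by (rule der)
    show "continuous_on UNIV (\<lambda>x. Blinfun (L x))"
    proof (rule continuous_on_blinfun_componentwise)
      show "continuous_on UNIV (\<lambda>x. blinfun_apply (Blinfun (L x)) i)" for i
        unfolding L unfolding L_def a_def b_def
        by (intro continuous_intros continuous_on_ccross param_partials_continuous)
    qed
    show "special_isotropic (range (blinfun_apply (Blinfun (L z))))" for z
      unfolding L unfolding L_def[abs_def]
      by (rule special_isotropic_ccross) (simp add: a_def b_def assms)
  qed
  moreover have "range (\<lambda>x::real^3. param (x$1) (x$2) (x$3)) = {param y1 y2 t | t y1 y2. True}"
  proof (safe; simp)
    fix y1 y2 t
    show "param y1 y2 t \<in> range (\<lambda>x::real^3. param (x$1) (x$2) (x$3))"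
      by (rule range_eqI[of _ _ "vector [y1, y2, t]"]) simp
  qed blast
  ultimately show ?thesis by simp
qed

end

section \<open>The hyperbolic solution of the evolution equations\<close>

lemma f_int_deriv: "(f_int has_real_derivative sqrt (cosh t)) (at t)"
proof -
  \<comment> \<open>The fundamental theorem of calculus needs an interval that contains \<open>0\<close> and has \<open>t\<close> inside.\<close>
  define a where "a = - \<bar>t\<bar> - 1"
  define b where "b = \<bar>t\<bar> + 1"
  have ab: "a \<le> 0" "0 \<le> b" "a < t" "t < b" by (auto simp: a_def b_def)
  have "(f_int has_vector_derivative sqrt (cosh t)) (at t within {a..b})"
    unfolding f_int_def[abs_def]
    using ab by (intro interval_integral_FTC2) (auto intro!: continuous_intros)
  then have "(f_int has_vector_derivative sqrt (cosh t)) (at t)"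
    using ab by (simp add: at_within_Icc_at)
  then show ?thesis
    by (simp add: has_real_derivative_iff_has_vector_derivative)
qed

lemma hyperbolic_deriv:
  shows sech_deriv: "((\<lambda>t. 1 / cosh t) has_real_derivative - tanh t / cosh t) (at t)"
    and tanh_deriv: "(tanh has_real_derivative 1 / (cosh t)\<^sup>2) (at t)"
    and sqrt_cosh_deriv: "((\<lambda>t. sqrt (cosh t)) has_real_derivative sqrt (cosh t) * tanh t / 2) (at t)"
    and inverse_sqrt_cosh_deriv:
      "((\<lambda>t. 1 / sqrt (cosh t)) has_real_derivative - tanh t / (2 * sqrt (cosh t))) (at t)"
proof -
  have c: "cosh t > 0" "sqrt (cosh t) * sqrt (cosh t) = cosh t"
    using cosh_real_pos[of t] by (simp_all add: less_imp_le)
  show "((\<lambda>t. 1 / cosh t) has_real_derivative - tanh t / cosh t) (at t)"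
    by (auto intro!: derivative_eq_intros simp: tanh_def)
  show "(tanh has_real_derivative 1 / (cosh t)\<^sup>2) (at t)"
  proof -
    have "1 - (tanh t)\<^sup>2 = ((cosh t)\<^sup>2 - (sinh t)\<^sup>2) / (cosh t)\<^sup>2"
      using c(1) by (simp add: tanh_def power_divide diff_divide_distrib)
    then show ?thesis
      using c(1) by (auto intro!: derivative_eq_intros simp: hyperbolic_pythagoras)
  qed
  show "((\<lambda>t. sqrt (cosh t)) has_real_derivative sqrt (cosh t) * tanh t / 2) (at t)"
    by (rule DERIV_cong[OF DERIV_chain2[OF DERIV_real_sqrt[OF c(1)] has_field_derivative_cosh[OF DERIV_ident]]])
       (use c in \<open>auto simp: tanh_def field_simps\<close>)
  then show "((\<lambda>t. 1 / sqrt (cosh t)) has_real_derivative - tanh t / (2 * sqrt (cosh t))) (at t)"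
    using c by (intro DERIV_cong[OF DERIV_divide[OF DERIV_const]]) (auto simp: divide_simps)
qed

lemma has_vector_derivative_ComplexI:
  assumes "(x has_real_derivative x') (at t)" "(y has_real_derivative y') (at t)"
    and "\<And>s. f s = Complex (x s) (y s)" "D = Complex x' y'"
  shows "(f has_vector_derivative D) (at t)"
  using assms by (simp add: has_vector_derivative_complex_iff)

lemma w_evolution:
  shows w1_deriv: "(w1 has_vector_derivative cnj (w2 t * w3 t)) (at t)"
    and w2_deriv: "(w2 has_vector_derivative - cnj (w1 t * w3 t)) (at t)"
    and w3_deriv: "(w3 has_vector_derivative - cnj (w1 t * w2 t)) (at t)"
  by (rule has_vector_derivative_ComplexI[OF tanh_deriv DERIV_const[of 0]]
      has_vector_derivative_ComplexI[OF sech_deriv DERIV_const[of 0]];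
      simp add: w1_def w2_def w3_def complex_eq_iff power2_eq_square)+

text \<open>In terms of \<open>c = sqrt (cosh t)\<close> the evolution equations are identities between rational functions
  of \<open>c\<close>, \<open>sinh t\<close> and the value of the integral, modulo \<open>sinh\<^sup>2 t = c\<^sup>4 - 1\<close>.\<close>

lemma pq1_deriv:
  "(pq1 B E has_vector_derivative (1/2) * cnj (w2 t * pq3 B C E F t + w3 t * pq2 B C E F t)) (at t)"
proof -
  define c where "c = sqrt (cosh t)"
  have c: "c \<noteq> 0" "cosh t = c * c" "tanh t = sinh t / (c * c)"
    using cosh_real_pos[of t] by (simp_all add: c_def less_imp_le tanh_def)
  have "((\<lambda>t. B * (f_int t * tanh t - 2 * sqrt (cosh t))) has_real_derivative
      B * f_int t / (cosh t * cosh t)) (at t)"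
    by (rule DERIV_cong, (rule f_int_deriv tanh_deriv sqrt_cosh_deriv derivative_intros)+)
       (simp add: algebra_simps power2_eq_square)
  moreover have "((\<lambda>t. E / sqrt (cosh t)) has_real_derivative
       - E * tanh t / (2 * sqrt (cosh t))) (at t)"
    using DERIV_cmult[OF inverse_sqrt_cosh_deriv[of t], of E] by simp
  ultimately show ?thesis
  proof (rule has_vector_derivative_ComplexI)
    show "pq1 B E t = Complex (B * (f_int t * tanh t - 2 * sqrt (cosh t))) (E / sqrt (cosh t))" for t
      by (simp add: complex_eq_iff pq1_def)
    show "(1/2) * cnj (w2 t * pq3 B C E F t + w3 t * pq2 B C E F t) = Complex (B * f_int t / (cosh t * cosh t)) (- E * tanh t / (2 * sqrt (cosh t)))"
      unfolding complex_eq_iff pq1_def pq2_def pq3_def w2_def w3_def c_def[symmetric]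
      using c(1) by (simp add: c divide_simps)
  qed
qed

lemma pq2_deriv:
  "(pq2 B C E F has_vector_derivative - (1/2) * cnj (w1 t * pq3 B C E F t + w3 t * pq1 B E t)) (at t)"
proof -
  define c where "c = sqrt (cosh t)"
  have c: "c \<noteq> 0" "cosh t = c * c" "tanh t = sinh t / (c * c)"
    using cosh_real_pos[of t] by (simp_all add: c_def less_imp_le tanh_def)
  have s: "sinh t * sinh t = c * c * (c * c) - 1"
    using cosh_square_eq[of t] by (simp add: c(2) power2_eq_square)
  have "((\<lambda>t. B * f_int t * (1 / cosh t) + C * sqrt (cosh t)) has_real_derivative
      B * (sqrt (cosh t) - f_int t * tanh t) / cosh t + C * sqrt (cosh t) * tanh t / 2) (at t)"
    by (rule DERIV_cong, (rule f_int_deriv sech_deriv sqrt_cosh_deriv derivative_intros)+) (simp add: field_simps)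
  moreover have "((\<lambda>t. E * sinh t / (2 * sqrt (cosh t)) + F / sqrt (cosh t)) has_real_derivative
       E * (sinh t * tanh t + 2 / cosh t) / (4 * sqrt (cosh t)) - F * tanh t / (2 * sqrt (cosh t))) (at t)"
  proof -
    have "((\<lambda>t. (E / 2 * sinh t + F) * (1 / sqrt (cosh t))) has_real_derivative
        E / 2 * cosh t * (1 / sqrt (cosh t)) + - tanh t / (2 * sqrt (cosh t)) * (E / 2 * sinh t + F)) (at t)"
      by (rule DERIV_cong, (rule inverse_sqrt_cosh_deriv derivative_intros)+) simp
    moreover have "E / 2 * cosh t * (1 / sqrt (cosh t)) + - tanh t / (2 * sqrt (cosh t)) * (E / 2 * sinh t + F)
      = E * (sinh t * tanh t + 2 / cosh t) / (4 * sqrt (cosh t)) - F * tanh t / (2 * sqrt (cosh t))"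
      unfolding c_def[symmetric] using c(1) s
      by (simp add: c divide_simps) algebra
    ultimately show ?thesis
      by (simp add: add_divide_distrib)
  qed
  ultimately show ?thesis
  proof (rule has_vector_derivative_ComplexI)
    show "pq2 B C E F t = Complex (B * f_int t * (1 / cosh t) + C * sqrt (cosh t)) (E * sinh t / (2 * sqrt (cosh t)) + F / sqrt (cosh t))" for t
      by (simp add: complex_eq_iff pq2_def)
    show "- (1/2) * cnj (w1 t * pq3 B C E F t + w3 t * pq1 B E t) = Complex (B * (sqrt (cosh t) - f_int t * tanh t) / cosh t + C * sqrt (cosh t) * tanh t / 2) (E * (sinh t * tanh t + 2 / cosh t) / (4 * sqrt (cosh t)) - F * tanh t / (2 * sqrt (cosh t)))"
      unfolding complex_eq_iff pq1_def pq2_def pq3_def w1_def w3_def c_def[symmetric]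
      using c(1) by (simp add: c divide_simps) (simp add: algebra_simps)
  qed
qed

text \<open>Changing the signs of \<open>C\<close> and \<open>F\<close> exchanges the second and third components, so the third
  equation follows from the second.\<close>

lemma pq3_eq_pq2: "pq3 B C E F = pq2 B (- C) E (- F)"
  by (simp add: fun_eq_iff pq2_def pq3_def)

lemma pq3_deriv:
  "(pq3 B C E F has_vector_derivative - (1/2) * cnj (w1 t * pq2 B C E F t + w2 t * pq1 B E t)) (at t)"
  using pq2_deriv[of B "- C" E "- F" t] pq3_eq_pq2[of B "- C" E "- F"]
  by (simp add: pq3_eq_pq2 w2_def w3_def)

text \<open>Up to sign, this is the coefficient of \<open>y\<^sub>1\<close> in the Kaehler form of the two quadric directions when
  the parameters are those of \<open>q\<close>, and the coefficient of \<open>y\<^sub>2\<close> when they are those of \<open>p\<close>.\<close>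

lemma Im_herm_linear_coefficient:
  "Im (w1 t * cnj (pq1 B E t) - w2 t * cnj (pq2 B C E F t) + cnj (w3 t) * pq3 B C E F t) = 0"
proof -
  define c where "c = sqrt (cosh t)"
  have c: "c \<noteq> 0" "cosh t = c * c" "tanh t = sinh t / (c * c)"
    using cosh_real_pos[of t] by (simp_all add: c_def less_imp_le tanh_def)
  show ?thesis
    unfolding w1_def w2_def w3_def pq1_def pq2_def pq3_def c_def[symmetric]
    using c(1) by (simp add: c divide_simps)
qed

text \<open>Here the non-elementary integral and all functions of \<open>t\<close> cancel, which leaves the condition on
  the parameters.\<close>

lemma Im_herm_constant_coefficient:
  "Im (pq1 B E t * cnj (pq1 B' E' t) - pq2 B C E F t * cnj (pq2 B' C' E' F' t)
       + pq3 B' C' E' F' t * cnj (pq3 B C E F t))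
   = 2 * ((B * E' + C * F') - (B' * E + C' * F))"
proof -
  define c where "c = sqrt (cosh t)"
  have c: "c \<noteq> 0" "cosh t = c * c" "tanh t = sinh t / (c * c)"
    using cosh_real_pos[of t] by (simp_all add: c_def less_imp_le tanh_def)
  show ?thesis
    unfolding pq1_def pq2_def pq3_def c_def[symmetric]
    using c(1) by (simp add: c divide_simps) (simp add: algebra_simps)
qed

theorem theorem10p3:
  fixes B C E F B' C' E' F' :: real
    and p1 p2 p3 q1 q2 q3 r1 r2 r3 :: "real \<Rightarrow> complex"
    and N :: "(complex^3) set"
  assumes params: "B * E' + C * F' = B' * E + C' * F"
    and p_def: "p1 = pq1 B E" "p2 = pq2 B C E F" "p3 = pq3 B C E F"
    and q_def: "q1 = pq1 B' E'" "q2 = pq2 B' C' E' F'" "q3 = pq3 B' C' E' F'"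
    and r1_ode: "\<And>t. (r1 has_vector_derivative
          (1/2) * (cnj (p2 t) * cnj (p3 t) + cnj (q3 t) * cnj (q2 t))) (at t)"
    and r2_ode: "\<And>t. (r2 has_vector_derivative
          (1/2) * (cnj (q3 t) * cnj (q1 t) - cnj (p1 t) * cnj (p3 t))) (at t)"
    and r3_ode: "\<And>t. (r3 has_vector_derivative
          - (1/2) * (cnj (p1 t) * cnj (q2 t) + cnj (p2 t) * cnj (q1 t))) (at t)"
    and r_init: "r1 0 = 0" "r2 0 = 0" "r3 0 = 0"
    and N_def: "N = {vector
          [of_real ((y1^2 + y2^2) / 2) * w1 t + of_real y1 * p1 t + of_real y2 * q1 t + r1 t,
           of_real ((y1^2 - y2^2) / 2) * w2 t + of_real y1 * p2 t - of_real y2 * q2 t + r2 t,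
           of_real (y1 * y2) * w3 t + of_real y1 * q3 t + of_real y2 * p3 t + r3 t]
          | (t::real) (y1::real) (y2::real). True}"
  shows "special_Lagrangian_where_nonsingular N"
proof -
  interpret quadric_evolution w1 w2 w3 p1 p2 p3 q1 q2 q3 r1 r2 r3
    unfolding p_def q_def
    by unfold_locales
       (rule w1_deriv w2_deriv w3_deriv pq1_deriv pq2_deriv pq3_deriv |
        use r1_ode r2_ode r3_ode in \<open>simp add: p_def q_def\<close>)+
  have "Im (herm (param_y1 y1 y2 t) (param_y2 y1 y2 t)) = 0" for y1 y2 t
  proof -
    \<comment> \<open>The coefficient of \<open>y\<^sub>1 y\<^sub>2\<close> is real because it consists of squared moduli.\<close>
    have "herm (param_y1 y1 y2 t) (param_y2 y1 y2 t) =
        of_real (y1 * y2) * (w1 t * cnj (w1 t) - w2 t * cnj (w2 t) + w3 t * cnj (w3 t))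
        + of_real y1 * (w1 t * cnj (q1 t) - w2 t * cnj (q2 t) + cnj (w3 t) * q3 t)
        + of_real y2 * cnj (w1 t * cnj (p1 t) - w2 t * cnj (p2 t) + cnj (w3 t) * p3 t)
        + (p1 t * cnj (q1 t) - p2 t * cnj (q2 t) + q3 t * cnj (p3 t))"
      by (simp add: herm_def sum_3 param_y1_def param_y2_def algebra_simps)
    moreover have "Im (w1 t * cnj (q1 t) - w2 t * cnj (q2 t) + cnj (w3 t) * q3 t) = 0"
      "Im (w1 t * cnj (p1 t) - w2 t * cnj (p2 t) + cnj (w3 t) * p3 t) = 0"
      unfolding p_def q_def by (rule Im_herm_linear_coefficient)+
    moreover have "Im (p1 t * cnj (q1 t) - p2 t * cnj (q2 t) + q3 t * cnj (p3 t)) = 0"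
      unfolding p_def q_def Im_herm_constant_coefficient using params by simp
    moreover have "Im (w1 t * cnj (w1 t) - w2 t * cnj (w2 t) + w3 t * cnj (w3 t)) = 0"
      by (simp add: w1_def w2_def w3_def)
    ultimately show ?thesis
      by (simp only: plus_complex.sel Im_complex_of_real Re_complex_of_real times_complex.sel cnj.sel)
  qed
  then have "special_Lagrangian_where_nonsingular {param y1 y2 t | t y1 y2. True}"
    by (rule special_Lagrangian_param)
  then show ?thesis
    by (simp only: N_def param_def)
qed

end
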